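(* Let $N\ge 1$, let $a_1<a_2<\dots<a_N$ be positive integers with $\gcd(a_1,\dots,a_N)=1$, let $S=\langle a_1,\dots,a_N\rangle$, and let $I\subseteq\Delta(a_1,\dots,a_N)$ be a non-empty set of gaps of $S$. Then $V_{(\beta;I)}\neq\emptyset$ for all $\beta\in S$ with $\beta\ge a_N$.
   Context: $\mathbb{N}$ denotes the positive integers. The numerical semigroup generated by $a_1,\dots,a_N$ is $S=\langle a_1,\dots,a_N\rangle=\{\sum_{i=1}^N n_ia_i : n_i\in\mathbb{N}\cup\{0\}\}$; the $a_i$ are not required to be a minimal set of generators. Its set of gaps is $\Delta(a_1,\dots,a_N)=\mathbb{N}\setminus S$, which is finite because $\gcd(a_1,\dots,a_N)=1$. To $\alpha=(\alpha_1,\dots,\alpha_M)\in\mathbb{C}^M$ one associates the linear recurrence $\mathcal{U}(\alpha):\ g_k+\alpha_1g_{k-1}+\dots+\alpha_Mg_{k-M}=0$. It is of order exactly $M$ if $\alpha_M\neq 0$. A solution is a complex sequence $(g_k)_{k\ge 0}$ satisfying this relation for all $k\ge M$; it is non-trivial if it is not identically zero. For $M\in\mathbb{N}$ and a non-empty finite set $I\subset\mathbb{N}$, the open linear recurrence variety $V_{(M;I)}$ is the set of all linear recurrences $\mathcal{U}(\alpha)$ of order exactly $M$ (identified with the points $\alpha\in\mathbb{C}^M$ with $\alpha_M\neq0$) that have a non-trivial solution $(g_k)$ with $g_i=0$ for all $i\in I$ (it may vanish at other points as well). *)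

theory Defs
  imports Complex_Main "HOL-Library.FuncSet"
begin

definition num_semigroup :: "nat \<Rightarrow> (nat \<Rightarrow> nat) \<Rightarrow> nat set" where
  "num_semigroup N a = {(\<Sum>i=1..N. n i * a i) | n :: nat \<Rightarrow> nat. True}"

definition gaps :: "nat \<Rightarrow> (nat \<Rightarrow> nat) \<Rightarrow> nat set" where
  "gaps N a = {k. k > 0} - num_semigroup N a"

(* A point (alpha_1, ..., alpha_M) of complex M-space is an extensional function on {1..M}. *)
definition cspace :: "nat \<Rightarrow> (nat \<Rightarrow> complex) set" where
  "cspace M = ({1..M} \<rightarrow>\<^sub>E UNIV)"

definition lin_rec_solution :: "nat \<Rightarrow> (nat \<Rightarrow> complex) \<Rightarrow> (nat \<Rightarrow> complex) \<Rightarrow> bool" where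
  "lin_rec_solution M \<alpha> g \<longleftrightarrow> (\<forall>k\<ge>M. g k + (\<Sum>j=1..M. \<alpha> j * g (k - j)) = 0)"

(* Intended for M > 0 and I a non-empty finite set of positive integers. *)
definition open_lin_rec_variety :: "nat \<Rightarrow> nat set \<Rightarrow> (nat \<Rightarrow> complex) set" where
  "open_lin_rec_variety M I =
     {\<alpha> \<in> cspace M. \<alpha> M \<noteq> 0 \<and>
        (\<exists>g. lin_rec_solution M \<alpha> g \<and> (\<exists>k. g k \<noteq> 0) \<and> (\<forall>i\<in>I. g i = 0))}"

end

theory Submission
  imports Defs
begin

text \<open>A numerical semigroup is closed under multiples, so no gap is divisible by an element
  \<open>\<beta>\<close> of the semigroup. Hence the indicator sequence of the multiples of \<open>\<beta>\<close> vanishes at every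
  gap. It has period \<open>\<beta>\<close>, so it solves the recurrence \<open>g k - g (k - \<beta>) = 0\<close>, whose order is
  exactly \<open>\<beta>\<close>, and it is non-trivial because its value at \<open>0\<close> is \<open>1\<close>. The bound
  \<open>\<beta> \<ge> a N\<close> serves only to make \<open>\<beta>\<close> positive.\<close>

lemma num_semigroup_dvd:
  assumes "\<beta> \<in> num_semigroup N a" "\<beta> dvd k"
  shows "k \<in> num_semigroup N a"
proof -
  obtain n where n: "\<beta> = (\<Sum>i=1..N. n i * a i)"
    using assms(1) unfolding num_semigroup_def by blast
  obtain m where "k = \<beta> * m"
    using assms(2) by (rule dvdE)
  then have "k = (\<Sum>i=1..N. (m * n i) * a i)"
    by (simp add: n sum_distrib_left mult.commute mult.left_commute)
  then show ?thesis
    unfolding num_semigroup_def by (intro CollectI exI[of _ "\<lambda>i. m * n i"]) simp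
qed

lemma open_lin_rec_variety_nonempty_if_not_dvd:
  assumes "M > 0" "\<forall>i\<in>I. \<not> M dvd i"
  shows "open_lin_rec_variety M I \<noteq> {}"
proof -
  define \<alpha> :: "nat \<Rightarrow> complex" where
    "\<alpha> = (\<lambda>j\<in>{1..M}. if j = M then - 1 else 0)"
  define g :: "nat \<Rightarrow> complex" where "g = (\<lambda>k. of_bool (M dvd k))"
  have "lin_rec_solution M \<alpha> g"
    unfolding lin_rec_solution_def
  proof (intro allI impI)
    fix k assume "k \<ge> M"
    have "(\<Sum>j=1..M. \<alpha> j * g (k - j)) = (\<Sum>j=1..M. if j = M then - g (k - j) else 0)"
      by (rule sum.cong) (auto simp: \<alpha>_def)
    also have "\<dots> = - g (k - M)"
      using \<open>M > 0\<close> by simp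
    also have "g (k - M) = g k"
      using \<open>k \<ge> M\<close> by (simp add: g_def dvd_minus_self)
    finally show "g k + (\<Sum>j=1..M. \<alpha> j * g (k - j)) = 0"
      by simp
  qed
  moreover have "g 0 \<noteq> 0"
    by (simp add: g_def)
  moreover have "\<forall>i\<in>I. g i = 0"
    using assms(2) by (simp add: g_def)
  moreover have "\<alpha> \<in> cspace M" "\<alpha> M \<noteq> 0"
    using \<open>M > 0\<close> by (simp_all add: \<alpha>_def cspace_def)
  ultimately have "\<alpha> \<in> open_lin_rec_variety M I"
    unfolding open_lin_rec_variety_def by blast
  then show ?thesis
    by blast
qed

theorem theorem2p1:
  fixes N :: nat and a :: "nat \<Rightarrow> nat" and I :: "nat set"
  assumes "N \<ge> 1"
    and "\<forall>i\<in>{1..N}. a i > 0"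
    and "strict_mono_on {1..N} a"
    and "Gcd (a ` {1..N}) = 1"
    and "I \<noteq> {}"
    and "I \<subseteq> gaps N a"
  shows "\<forall>\<beta>\<in>num_semigroup N a. \<beta> \<ge> a N \<longrightarrow> open_lin_rec_variety \<beta> I \<noteq> {}"
proof (intro ballI impI)
  fix \<beta> assume \<beta>: "\<beta> \<in> num_semigroup N a" and "\<beta> \<ge> a N"
  have "a N > 0"
    using assms(1,2) by simp
  with \<open>\<beta> \<ge> a N\<close> have "\<beta> > 0"
    by linarith
  moreover have "\<forall>i\<in>I. \<not> \<beta> dvd i"
    using num_semigroup_dvd[OF \<beta>] assms(6) unfolding gaps_def by blast
  ultimately show "open_lin_rec_variety \<beta> I \<noteq> {}"
    by (rule open_lin_rec_variety_nonempty_if_not_dvd)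
qed

end
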